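(* Let $A$ be a commutative ring with identity. For every $f\in A$, the basic open set $U_f$ of $\operatorname{Sq} A$ is quasi-compact. In particular, $\operatorname{Sq} A$ is quasi-compact.
   Context: A proper ideal $\mathfrak{q}$ of $A$ is called quasi-prime if whenever $fg\in\mathfrak{q}$ with $f,g\in A$, then $f\in\sqrt{\mathfrak{q}}$ or $g\in\sqrt{\mathfrak{q}}$. The quasi-prime spectrum $\operatorname{Sq} A$ is the set of all quasi-prime ideals of $A$, with the topology having as basis of opens the sets $U_f=\{\mathfrak{q}\in\operatorname{Sq} A: \mathfrak{q}\cap S_f=\emptyset\}$ for $f\in A$, where $S_f=\{f^i : i\ge 0\}=\{1,f,f^2,\dots\}$ (one has $U_1=\operatorname{Sq} A$ and $U_f\cap U_g=U_{fg}$). Quasi-compact means every open cover has a finite subcover (no Hausdorff assumption). *)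

theory Defs
  imports "HOL-Analysis.Abstract_Topology" "HOL-Algebra.Ideal"
begin

definition radical :: "('a, 'b) ring_scheme \<Rightarrow> 'a set \<Rightarrow> 'a set" where
  "radical R I = {a \<in> carrier R. \<exists>n::nat. n > 0 \<and> a [^]\<^bsub>R\<^esub> n \<in> I}"

locale quasi_primeideal = ideal + cring +
  assumes I_notcarr: "carrier R \<noteq> I"
    and I_quasi_prime: "\<lbrakk>f \<in> carrier R; g \<in> carrier R; f \<otimes> g \<in> I\<rbrakk>
      \<Longrightarrow> f \<in> radical R I \<or> g \<in> radical R I"

definition Sq :: "('a, 'b) ring_scheme \<Rightarrow> 'a set set" where
  "Sq R = {\<qq>. quasi_primeideal \<qq> R}"

definition powers :: "('a, 'b) ring_scheme \<Rightarrow> 'a \<Rightarrow> 'a set" where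
  "powers R f = {f [^]\<^bsub>R\<^esub> i | i::nat. True}"

definition Sq_basic_open :: "('a, 'b) ring_scheme \<Rightarrow> 'a \<Rightarrow> 'a set set" where
  "Sq_basic_open R f = {\<qq> \<in> Sq R. \<qq> \<inter> powers R f = {}}"

text \<open>
  The topology having the sets \<^term>\<open>Sq_basic_open R f\<close> as a basis. For commutative \<^term>\<open>R\<close>
  their unions do form a topology, on all of \<^term>\<open>Sq R\<close>; see the lemmas \<open>cring.openin_Sq_topology\<close>
  and \<open>cring.topspace_Sq_topology\<close> below.
\<close>
definition Sq_topology :: "('a, 'b) ring_scheme \<Rightarrow> 'a set topology" where
  "Sq_topology R = topology (arbitrary union_of (\<lambda>U. \<exists>f \<in> carrier R. U = Sq_basic_open R f))"

lemma Sq_basic_open_iff: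
  "\<qq> \<in> Sq_basic_open R f \<longleftrightarrow> \<qq> \<in> Sq R \<and> (\<forall>i::nat. f [^]\<^bsub>R\<^esub> i \<notin> \<qq>)"
  unfolding Sq_basic_open_def powers_def by blast

lemma (in cring) Sq_basic_open_one:
  shows "Sq_basic_open R \<one> = Sq R"
proof -
  have "\<one> \<notin> \<qq>" if "\<qq> \<in> Sq R" for \<qq>
  proof
    assume one: "\<one> \<in> \<qq>"
    interpret quasi_primeideal \<qq> R using that by (simp add: Sq_def)
    show False using one_imp_carrier[OF one] I_notcarr by simp
  qed
  then show ?thesis by (auto simp: Sq_basic_open_iff)
qed

lemma (in cring) Sq_basic_open_Int:
  assumes "f \<in> carrier R" "g \<in> carrier R"
  shows "Sq_basic_open R f \<inter> Sq_basic_open R g = Sq_basic_open R (f \<otimes> g)"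
proof -
  note carr = assms
  have "(\<forall>i::nat. f [^] i \<notin> \<qq>) \<and> (\<forall>i::nat. g [^] i \<notin> \<qq>) \<longleftrightarrow> (\<forall>i::nat. (f \<otimes> g) [^] i \<notin> \<qq>)"
    if "\<qq> \<in> Sq R" for \<qq>
  proof -
    interpret q: quasi_primeideal \<qq> R using that by (simp add: Sq_def)
    have dist: "(f \<otimes> g) [^] i = f [^] i \<otimes> g [^] i" for i :: nat
      using carr by (rule nat_pow_distrib)
    show ?thesis
    proof (intro iffI conjI allI notI)
      fix i :: nat
      assume no: "(\<forall>i::nat. f [^] i \<notin> \<qq>) \<and> (\<forall>i::nat. g [^] i \<notin> \<qq>)"
        and "(f \<otimes> g) [^] i \<in> \<qq>"
      then have "f [^] i \<in> radical R \<qq> \<or> g [^] i \<in> radical R \<qq>"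
        using q.I_quasi_prime carr by (simp add: dist)
      then show False using no carr by (auto simp: radical_def nat_pow_pow)
    next
      fix i :: nat
      assume "\<forall>i::nat. (f \<otimes> g) [^] i \<notin> \<qq>" "f [^] i \<in> \<qq>"
      then show False using carr q.I_r_closed[of "f [^] i" "g [^] i"] by (auto simp: dist)
    next
      fix i :: nat
      assume "\<forall>i::nat. (f \<otimes> g) [^] i \<notin> \<qq>" "g [^] i \<in> \<qq>"
      then show False using carr q.I_l_closed[of "g [^] i" "f [^] i"] by (auto simp: dist)
    qed
  qed
  then show ?thesis unfolding set_eq_iff Int_iff Sq_basic_open_iff by blast
qed

lemma (in cring) openin_Sq_topology:
  shows "openin (Sq_topology R) =
    arbitrary union_of (\<lambda>U. \<exists>f \<in> carrier R. U = Sq_basic_open R f)"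
proof -
  have "istopology (arbitrary union_of (\<lambda>U. \<exists>f \<in> carrier R. U = Sq_basic_open R f))"
    by (rule istopology_base) (metis Sq_basic_open_Int m_closed)
  then show ?thesis by (simp add: Sq_topology_def)
qed

lemma (in cring) topspace_Sq_topology:
  shows "topspace (Sq_topology R) = Sq R"
proof
  have "S \<subseteq> Sq R" if "openin (Sq_topology R) S" for S
    using that by (auto simp: openin_Sq_topology union_of_def Sq_basic_open_def)
  then show "topspace (Sq_topology R) \<subseteq> Sq R" by (simp add: openin_topspace)
  have "openin (Sq_topology R) (Sq R)"
    unfolding openin_Sq_topology
    by (rule union_of_inc) (auto simp: arbitrary_def intro!: bexI[of _ "\<one>"]
        Sq_basic_open_one[symmetric])
  then show "Sq R \<subseteq> topspace (Sq_topology R)" by (rule openin_subset)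
qed

end

theory Submission
  imports Defs "HOL-Algebra.Ring_Divisibility"
begin

text \<open>
  The proof turns a covering problem into an ideal. For a family \<open>\<U>\<close> of sets of ideals, call
  \<open>a\<close> finitely covered if finitely many members of \<open>\<U>\<close> cover \<open>U\<^sub>a\<close>. The inclusions
  \<open>U\<^sub>a\<^sub>+\<^sub>b \<subseteq> U\<^sub>a \<union> U\<^sub>b\<close> and \<open>U\<^sub>r\<^sub>a \<subseteq> U\<^sub>a\<close>, together with \<open>U\<^sub>0 = {}\<close>, show that the finitely
  covered elements form an ideal \<open>J\<close> (\<open>finitely_covered_ideal\<close>). The first inclusion holds because
  \<open>(a + b)\<^sup>m\<^sup>+\<^sup>n\<close> lies in every ideal that contains \<open>a\<^sup>m\<close> and \<open>b\<^sup>n\<close>.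

  Let \<open>\<U>\<close> be an open cover of \<open>U\<^sub>f\<close> and suppose that \<open>f \<notin> J\<close>. As \<open>U\<^sub>f\<close> is contained in the basic
  open set of each power of \<open>f\<close>, no power of \<open>f\<close> lies in \<open>J\<close>. Krull's lemma
  (\<open>exists_primeideal_avoiding\<close>) yields a prime ideal \<open>P\<close> that contains \<open>J\<close> and no power of \<open>f\<close>.
  Prime ideals are quasi-prime, so \<open>P\<close> is a point of \<open>U\<^sub>f\<close>, and therefore \<open>P \<in> U\<^sub>g \<subseteq> U\<close> for some \<open>g\<close>
  and some \<open>U \<in> \<U>\<close>. The single set \<open>U\<close> covers \<open>U\<^sub>g\<close>, hence \<open>g \<in> J \<subseteq> P\<close>, whereas \<open>P \<in> U\<^sub>g\<close> means
  that \<open>P\<close> contains no power of \<open>g\<close>: a contradiction.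
\<close>

text \<open>
  The binomial theorem would give this for \<open>c = \<one>\<close>: each monomial of \<open>(a \<oplus> b) [^] (m + n)\<close> is
  divisible by \<open>a [^] m\<close> or by \<open>b [^] n\<close>. The factor \<open>c\<close> allows an induction in its place: one
  factor \<open>a \<oplus> b\<close> is expanded, and the \<open>a\<close> or the \<open>b\<close> that it contributes is absorbed into \<open>c\<close>.
\<close>
lemma (in cring) mult_add_pow_mem_ideal:
  assumes "ideal I R" "a \<in> carrier R" "b \<in> carrier R" "c \<in> carrier R"
    and "c \<otimes> a [^] (m::nat) \<in> I" "c \<otimes> b [^] (n::nat) \<in> I"
  shows "c \<otimes> (a \<oplus> b) [^] (m + n) \<in> I"
  using assms(4-6)
proof (induction "m + n" arbitrary: m n c)
  case 0
  then show ?case by simp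
next
  case (Suc k)
  interpret ideal I R by fact
  note carr = assms(2,3) Suc.prems(1)
  show ?case
  proof (cases "m = 0 \<or> n = 0")
    case True
    then have "c \<in> I" using Suc.prems carr by auto
    then show ?thesis using carr by (simp add: I_r_closed)
  next
    case False
    then obtain m' n' where mn: "m = Suc m'" "n = Suc n'"
      by (metis not0_implies_Suc)
    have "(c \<otimes> a) \<otimes> (a \<oplus> b) [^] (m' + n) \<in> I"
    proof (rule Suc.hyps(1))
      show "k = m' + n" using Suc.hyps(2) mn by simp
      show "c \<otimes> a \<otimes> a [^] m' \<in> I"
        using Suc.prems(2) carr by (simp add: mn m_ac)
      have "c \<otimes> a \<otimes> b [^] n = a \<otimes> (c \<otimes> b [^] n)"
        using carr by (simp add: m_ac)
      then show "c \<otimes> a \<otimes> b [^] n \<in> I"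
        using Suc.prems(3) carr by (simp add: I_l_closed)
    qed (use carr in simp)
    moreover have "(c \<otimes> b) \<otimes> (a \<oplus> b) [^] (m + n') \<in> I"
    proof (rule Suc.hyps(1))
      show "k = m + n'" using Suc.hyps(2) mn by simp
      show "c \<otimes> b \<otimes> b [^] n' \<in> I"
        using Suc.prems(3) carr by (simp add: mn m_ac)
      have "c \<otimes> b \<otimes> a [^] m = b \<otimes> (c \<otimes> a [^] m)"
        using carr by (simp add: m_ac)
      then show "c \<otimes> b \<otimes> a [^] m \<in> I"
        using Suc.prems(2) carr by (simp add: I_l_closed)
    qed (use carr in simp)
    moreover have "c \<otimes> (a \<oplus> b) [^] (m + n) =
        (c \<otimes> a) \<otimes> (a \<oplus> b) [^] (m' + n) \<oplus> (c \<otimes> b) \<otimes> (a \<oplus> b) [^] (m + n')"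
    proof -
      define s where "s = (a \<oplus> b) [^] (m' + n)"
      have s: "s \<in> carrier R" using carr by (simp add: s_def)
      have "(a \<oplus> b) [^] (m + n) = (a \<oplus> b) \<otimes> s"
        using carr by (simp add: mn s_def m_ac)
      moreover have "(a \<oplus> b) [^] (m + n') = s"
        by (simp add: mn s_def)
      ultimately show ?thesis
        using carr s by (simp add: s_def[symmetric] l_distr r_distr m_assoc)
    qed
    ultimately show ?thesis by (simp add: a_closed)
  qed
qed

lemma (in cring) Sq_basic_open_zero: "Sq_basic_open R \<zero> = {}"
proof -
  have "\<zero> \<in> \<qq>" if "\<qq> \<in> Sq R" for \<qq>
  proof -
    interpret quasi_primeideal \<qq> R using that by (simp add: Sq_def)
    show ?thesis by simp
  qed
  then have "\<exists>i::nat. \<zero> [^] i \<in> \<qq>" if "\<qq> \<in> Sq R" for \<qq>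
    using that by (intro exI[of _ 1]) simp
  then show ?thesis unfolding set_eq_iff Sq_basic_open_iff by blast
qed

lemma (in cring) Sq_basic_open_mult_subset:
  assumes "r \<in> carrier R" "a \<in> carrier R"
  shows "Sq_basic_open R (r \<otimes> a) \<subseteq> Sq_basic_open R a"
  using Sq_basic_open_Int[OF assms] by blast

lemma (in cring) Sq_basic_open_add_subset:
  assumes "a \<in> carrier R" "b \<in> carrier R"
  shows "Sq_basic_open R (a \<oplus> b) \<subseteq> Sq_basic_open R a \<union> Sq_basic_open R b"
proof
  fix \<qq> assume q: "\<qq> \<in> Sq_basic_open R (a \<oplus> b)"
  then have "ideal \<qq> R"
    by (simp add: Sq_basic_open_iff Sq_def quasi_primeideal_def)
  then have "(a \<oplus> b) [^] (m + n) \<in> \<qq>" if "a [^] m \<in> \<qq>" "b [^] n \<in> \<qq>" for m n :: nat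
    using mult_add_pow_mem_ideal[of \<qq> a b \<one> m n] that assms by simp
  then show "\<qq> \<in> Sq_basic_open R a \<union> Sq_basic_open R b"
    using q by (auto simp: Sq_basic_open_iff)
qed

lemma (in cring) Sq_basic_open_subset_pow:
  assumes "f \<in> carrier R"
  shows "Sq_basic_open R f \<subseteq> Sq_basic_open R (f [^] (n::nat))"
  using assms by (auto simp: Sq_basic_open_iff nat_pow_pow)

lemma (in cring) finitely_covered_ideal:
  "ideal {a \<in> carrier R. \<exists>\<F>. finite \<F> \<and> \<F> \<subseteq> \<U> \<and> Sq_basic_open R a \<subseteq> \<Union>\<F>} R"
    (is "ideal ?J R")
proof -
  have mult: "r \<otimes> a \<in> ?J" if "a \<in> ?J" "r \<in> carrier R" for a r
    using that Sq_basic_open_mult_subset[of r a] by (simp, meson subset_trans)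
  show ?thesis
  proof (rule idealI[OF ring_axioms])
    show "subgroup ?J (add_monoid R)"
    proof (rule add.subgroupI)
      show "?J \<noteq> {}"
        using Sq_basic_open_zero by (auto intro!: exI[of _ \<zero>] exI[of _ "{}"])
      show "\<ominus> a \<in> ?J" if "a \<in> ?J" for a
        using mult[OF that, of "\<ominus> \<one>"] that by (simp add: l_minus)
      show "a \<oplus> b \<in> ?J" if ab: "a \<in> ?J" "b \<in> ?J" for a b
      proof -
        obtain \<F> \<G> where "finite \<F>" "\<F> \<subseteq> \<U>" "Sq_basic_open R a \<subseteq> \<Union>\<F>"
            "finite \<G>" "\<G> \<subseteq> \<U>" "Sq_basic_open R b \<subseteq> \<Union>\<G>"
          using ab by blast
        moreover have "Sq_basic_open R (a \<oplus> b) \<subseteq> Sq_basic_open R a \<union> Sq_basic_open R b"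
          using ab by (simp add: Sq_basic_open_add_subset)
        ultimately have "finite (\<F> \<union> \<G>) \<and> \<F> \<union> \<G> \<subseteq> \<U> \<and> Sq_basic_open R (a \<oplus> b) \<subseteq> \<Union>(\<F> \<union> \<G>)"
          by blast
        then show ?thesis using ab by blast
      qed
    qed auto
    show "r \<otimes> a \<in> ?J" if "a \<in> ?J" "r \<in> carrier R" for a r
      using mult that by blast
    show "a \<otimes> r \<in> ?J" if "a \<in> ?J" "r \<in> carrier R" for a r
      using mult[OF that] that by (simp add: m_comm)
  qed
qed

text \<open>
  Krull's lemma. Zorn's lemma gives an ideal \<open>P\<close> that is maximal among those that contain \<open>I\<close> and
  miss \<open>S\<close>. If \<open>a\<close> and \<open>b\<close> are not in \<open>P\<close>, then \<open>P + (a)\<close> and \<open>P + (b)\<close> both meet \<open>S\<close>; the product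
  of an element of each kind is in \<open>S\<close>, and it would be in \<open>P\<close> if \<open>a \<otimes> b\<close> were.
\<close>
lemma (in cring) exists_primeideal_avoiding:
  assumes "ideal I R" "S \<subseteq> carrier R" "S \<noteq> {}" "I \<inter> S = {}"
    and mult: "\<And>s t. s \<in> S \<Longrightarrow> t \<in> S \<Longrightarrow> s \<otimes> t \<in> S"
  obtains P where "primeideal P R" "I \<subseteq> P" "P \<inter> S = {}"
proof -
  define \<A> where "\<A> = {K. ideal K R \<and> I \<subseteq> K \<and> K \<inter> S = {}}"
  have "\<exists>P\<in>\<A>. \<forall>X\<in>\<A>. P \<subseteq> X \<longrightarrow> X = P"
  proof (rule subset_Zorn_nonempty)
    show "\<A> \<noteq> {}" using assms by (auto simp: \<A>_def)
    fix \<C> assume C: "\<C> \<noteq> {}" "subset.chain \<A> \<C>"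
    then have sub: "\<C> \<subseteq> \<A>" by (simp add: subset_chain_def)
    have "subset.chain {K. ideal K R} \<C>"
      using C(2) by (auto simp: subset_chain_def \<A>_def)
    then have "ideal (\<Union>\<C>) R" using chain_Union_is_ideal[of \<C>] C(1) by simp
    then show "\<Union>\<C> \<in> \<A>" using sub C(1) by (auto simp: \<A>_def)
  qed
  then obtain P where P: "ideal P R" "I \<subseteq> P" "P \<inter> S = {}"
    and max: "\<And>X. X \<in> \<A> \<Longrightarrow> P \<subseteq> X \<Longrightarrow> X = P" by (auto simp: \<A>_def)
  interpret P: ideal P R by fact
  have meets: "\<exists>s\<in>S. \<exists>p\<in>P. \<exists>r\<in>carrier R. s = p \<oplus> r \<otimes> a" if a: "a \<in> carrier R" "a \<notin> P" for a
  proof -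
    let ?K = "P <+>\<^bsub>R\<^esub> PIdl a"
    have K: "ideal ?K R" by (intro add_ideals P(1) cgenideal_ideal a(1))
    have mem: "x \<in> ?K \<longleftrightarrow> (\<exists>p\<in>P. \<exists>r\<in>carrier R. x = p \<oplus> r \<otimes> a)" for x
      by (auto simp: set_add_def' cgenideal_def)
    have "P \<subseteq> ?K"
    proof
      fix p assume "p \<in> P"
      moreover from this have "p = p \<oplus> \<zero> \<otimes> a" using a(1) by (simp add: P.Icarr)
      ultimately show "p \<in> ?K" using mem by blast
    qed
    moreover have "a \<in> ?K"
    proof -
      have "a = \<zero> \<oplus> \<one> \<otimes> a" using a(1) by simp
      then show ?thesis using mem P.zero_closed by blast
    qed
    ultimately have "?K \<notin> \<A>" using max a(2) by blast
    then show ?thesis using K P(2) \<open>P \<subseteq> ?K\<close> mem by (auto simp: \<A>_def)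
  qed
  have "primeideal P R"
  proof (rule primeidealI[OF P(1) is_cring])
    show "carrier R \<noteq> P" using P(3) assms(2,3) by blast
    fix a b assume ab: "a \<in> carrier R" "b \<in> carrier R" "a \<otimes> b \<in> P"
    show "a \<in> P \<or> b \<in> P"
    proof (rule ccontr)
      assume "\<not> (a \<in> P \<or> b \<in> P)"
      then obtain s p r t p' r' where
        s: "s \<in> S" "p \<in> P" "r \<in> carrier R" "s = p \<oplus> r \<otimes> a" and
        t: "t \<in> S" "p' \<in> P" "r' \<in> carrier R" "t = p' \<oplus> r' \<otimes> b"
        using meets[of a] meets[of b] ab by blast
      have carr: "p \<in> carrier R" "p' \<in> carrier R" "t \<in> carrier R"
        using s t P.Icarr assms(2) by auto
      have "s \<otimes> t = p \<otimes> t \<oplus> ((r \<otimes> a) \<otimes> p' \<oplus> (r \<otimes> r') \<otimes> (a \<otimes> b))"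
        using carr s(3) t(3) ab by (simp add: s(4) t(4) l_distr r_distr m_ac)
      also have "\<dots> \<in> P"
        using carr s(2,3) t(2,3) ab by (simp add: P.a_closed P.I_l_closed P.I_r_closed)
      finally show False using mult[OF s(1) t(1)] P(3) by blast
    qed
  qed
  then show ?thesis using that P by blast
qed

lemma (in primeideal) primeideal_in_Sq: "I \<in> Sq R"
proof -
  have "I \<subseteq> radical R I"
    using Icarr by (auto simp: radical_def intro!: exI[of _ "1::nat"])
  then have "quasi_primeideal I R"
    using I_prime I_notcarr
    by (intro quasi_primeideal.intro quasi_primeideal_axioms.intro is_ideal is_cring) auto
  then show ?thesis by (simp add: Sq_def)
qed

lemma (in cring) compactin_Sq_basic_open:
  assumes f: "f \<in> carrier R"
  shows "compactin (Sq_topology R) (Sq_basic_open R f)"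
  unfolding compactin_def
proof (intro conjI allI impI)
  show "Sq_basic_open R f \<subseteq> topspace (Sq_topology R)"
    by (auto simp: topspace_Sq_topology Sq_basic_open_def)
  fix \<U>
  assume "(\<forall>U\<in>\<U>. openin (Sq_topology R) U) \<and> Sq_basic_open R f \<subseteq> \<Union>\<U>"
  then have opn: "\<And>U. U \<in> \<U> \<Longrightarrow> openin (Sq_topology R) U"
    and cover: "Sq_basic_open R f \<subseteq> \<Union>\<U>" by blast+
  define J where
    "J = {a \<in> carrier R. \<exists>\<F>. finite \<F> \<and> \<F> \<subseteq> \<U> \<and> Sq_basic_open R a \<subseteq> \<Union>\<F>}"
  have "f \<in> J"
  proof (rule ccontr)
    assume nf: "f \<notin> J"
    have avoid: "J \<inter> powers R f = {}"
    proof -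
      have "f [^] i \<notin> J" for i :: nat
        using nf f Sq_basic_open_subset_pow[OF f, of i]
        by (simp add: J_def) (meson subset_trans)
      then show ?thesis by (auto simp: powers_def)
    qed
    have J: "ideal J R" unfolding J_def by (rule finitely_covered_ideal)
    have closed: "s \<otimes> t \<in> powers R f" if "s \<in> powers R f" "t \<in> powers R f" for s t
      using that f by (auto simp: powers_def nat_pow_mult)
    have "powers R f \<subseteq> carrier R" "powers R f \<noteq> {}"
      using f by (auto simp: powers_def)
    then obtain P where P: "primeideal P R" "J \<subseteq> P" "P \<inter> powers R f = {}"
      using exists_primeideal_avoiding[OF J _ _ avoid closed] by blast
    then have "P \<in> Sq_basic_open R f"
      by (simp add: Sq_basic_open_def primeideal.primeideal_in_Sq)
    then obtain U where U: "U \<in> \<U>" "P \<in> U" using cover by blast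
    then obtain g where g: "g \<in> carrier R" "P \<in> Sq_basic_open R g" "Sq_basic_open R g \<subseteq> U"
      using opn[OF U(1)] unfolding openin_Sq_topology arbitrary_union_of_alt by blast
    have "g \<in> J"
      using g U(1) by (auto simp: J_def intro!: exI[of _ "{U}"])
    then have "g [^] (1::nat) \<in> P" using P(2) g(1) by auto
    then show False using g(2) by (auto simp only: Sq_basic_open_iff)
  qed
  then show "\<exists>\<F>. finite \<F> \<and> \<F> \<subseteq> \<U> \<and> Sq_basic_open R f \<subseteq> \<Union>\<F>"
    by (simp add: J_def)
qed

theorem theorem2p3:
  fixes A :: "('a, 'b) ring_scheme"
  assumes "cring A"
  shows "(\<forall>f \<in> carrier A. compactin (Sq_topology A) (Sq_basic_open A f)) \<and>
    compact_space (Sq_topology A)"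
proof -
  interpret cring A by fact
  have "compactin (Sq_topology A) (Sq_basic_open A \<one>\<^bsub>A\<^esub>)"
    by (simp add: compactin_Sq_basic_open)
  then have "compact_space (Sq_topology A)"
    by (simp add: compact_space_def topspace_Sq_topology Sq_basic_open_one)
  then show ?thesis by (simp add: compactin_Sq_basic_open)
qed

end
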